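(* Let $n\ge 4$ be a natural number. Under the disjointness criterion, the geometric pseudo-Grundy index of the complete graph satisfies $$\gamma'_g(K_n)\le \frac{n^2}{4}+\Theta(n).$$
   Context: A geometric graph of a graph $G$ is a drawing of $G$ in the plane in which the vertices are points in general position (no three collinear) and every edge is the straight-line segment joining its endpoints. Two distinct edges intersect if they share an endpoint or cross (meet at a point interior to both segments); they are disjoint if they do not intersect. Disjointness criterion: two edges are adjacent if and only if they are disjoint. A pseudo-Grundy $k$-coloring of a geometric graph $\mathsf{G}$ is an assignment of the colors $1,\dots,k$ to all the edges (not necessarily proper), with every color used, such that for every pair of colors $i<j$, every edge of color $j$ is adjacent to at least one edge of color $i$. The pseudo-Grundy index $\gamma'(\mathsf{G})$ is the largest $k$ for which $\mathsf{G}$ has a pseudo-Grundy $k$-coloring. The geometric pseudo-Grundy index of a graph $G$ is $\gamma'_g(G)=\min\{\gamma'(\mathsf{G}) : \mathsf{G}\text{ is a geometric graph of } G\}$. The term $\Theta(n)$ in the upper bound denotes an error term that is linear in $n$: there is a constant $C>0$ such that $\gamma'_g(K_n)\le \frac{n^2}{4}+Cn$. *)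

theory Defs
  imports "HOL-Analysis.Analysis"
begin

text \<open>A graph is a pair of a vertex set and a set of edges, each edge being the two-element
  set of its endpoints.\<close>

type_synonym 'a graph = "'a set \<times> 'a set set"

definition complete_graph :: "nat \<Rightarrow> nat graph" where
  "complete_graph n = ({..<n}, {e. e \<subseteq> {..<n} \<and> card e = 2})"

definition general_position :: "(real ^ 2) set \<Rightarrow> bool" where
  "general_position P \<longleftrightarrow> (\<forall>T\<subseteq>P. card T = 3 \<longrightarrow> \<not> collinear T)"

text \<open>A geometric graph is a graph whose vertices are points of the plane; an edge
  \<open>{a, b}\<close> stands for the straight-line segment from \<open>a\<close> to \<open>b\<close>.\<close>

definition geometric_graph_of :: "(real ^ 2) graph \<Rightarrow> 'a graph \<Rightarrow> bool" where
  "geometric_graph_of D G \<longleftrightarrow>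
     (\<exists>p. inj_on p (fst G) \<and> D = (p ` fst G, (\<lambda>e. p ` e) ` snd G)
          \<and> general_position (fst D))"

definition edges_cross :: "(real ^ 2) set \<Rightarrow> (real ^ 2) set \<Rightarrow> bool" where
  "edges_cross e f \<longleftrightarrow>
     (\<exists>a b c d. e = {a, b} \<and> f = {c, d} \<and> open_segment a b \<inter> open_segment c d \<noteq> {})"

definition edges_intersect :: "(real ^ 2) set \<Rightarrow> (real ^ 2) set \<Rightarrow> bool" where
  "edges_intersect e f \<longleftrightarrow> e \<inter> f \<noteq> {} \<or> edges_cross e f"

text \<open>Adjacency of edges under the disjointness criterion.\<close>

definition edges_adjacent :: "(real ^ 2) set \<Rightarrow> (real ^ 2) set \<Rightarrow> bool" where
  "edges_adjacent e f \<longleftrightarrow> e \<noteq> f \<and> \<not> edges_intersect e f"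

definition pseudo_grundy_coloring ::
    "(real ^ 2) graph \<Rightarrow> nat \<Rightarrow> ((real ^ 2) set \<Rightarrow> nat) \<Rightarrow> bool" where
  "pseudo_grundy_coloring D k c \<longleftrightarrow>
     c ` snd D = {1..k} \<and>
     (\<forall>i\<in>{1..k}. \<forall>j\<in>{1..k}. i < j \<longrightarrow>
        (\<forall>e\<in>snd D. c e = j \<longrightarrow> (\<exists>f\<in>snd D. c f = i \<and> edges_adjacent e f)))"

definition pseudo_grundy_index :: "(real ^ 2) graph \<Rightarrow> nat" where
  "pseudo_grundy_index D = Max {k. \<exists>c. pseudo_grundy_coloring D k c}"

definition geometric_pseudo_grundy_index :: "'a graph \<Rightarrow> nat" where
  "geometric_pseudo_grundy_index G =
     Inf {pseudo_grundy_index D | D. geometric_graph_of D G}"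

text \<open>The maximum and the infimum above are attained: for a finite edge set the numbers of
  colors form a finite nonempty set, and complete graphs have drawings, so that the infimum is
  that of a nonempty set of natural numbers.\<close>

lemma finite_pseudo_grundy:
  assumes "finite (snd D)"
  shows "finite {k. \<exists>c. pseudo_grundy_coloring D k c}"
proof (rule finite_subset)
  have "k \<le> card (snd D)" if "pseudo_grundy_coloring D k c" for k c
  proof -
    have "c ` snd D = {1..k}" using that by (simp add: pseudo_grundy_coloring_def)
    then have "card {1..k} \<le> card (snd D)" using card_image_le[OF assms] by metis
    then show ?thesis by simp
  qed
  then show "{k. \<exists>c. pseudo_grundy_coloring D k c} \<subseteq> {..card (snd D)}" by auto
qed simp

lemma ex_pseudo_grundy: "\<exists>k c. pseudo_grundy_coloring D k c"
proof (cases "snd D = {}")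
  case True
  then have "pseudo_grundy_coloring D 0 (\<lambda>_. 1)" by (simp add: pseudo_grundy_coloring_def)
  then show ?thesis by blast
next
  case False
  then have "pseudo_grundy_coloring D 1 (\<lambda>_. 1)" by (auto simp: pseudo_grundy_coloring_def)
  then show ?thesis by blast
qed

lemma ex_drawing_complete_graph: "\<exists>D. geometric_graph_of D (complete_graph n)"
proof -
  define p :: "nat \<Rightarrow> real ^ 2" where "p k = vector [real k, real k ^ 2]" for k
  have p1: "p k $ 1 = real k" and p2: "p k $ 2 = real k ^ 2" for k
    by (simp_all add: p_def vector_2)
  have inj: "inj_on p A" for A
    by (rule inj_onI) (metis p1 of_nat_eq_iff)
  have "\<not> collinear T" if T: "T \<subseteq> p ` {..<n}" "card T = 3" for T
  proof
    assume col: "collinear T"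
    obtain x y z where xyz: "T = {x, y, z}" "x \<noteq> y" "x \<noteq> z" "y \<noteq> z"
      using T(2) by (auto simp: card_3_iff)
    obtain i j k where ijk: "x = p i" "y = p j" "z = p k" using T(1) xyz(1) by auto
    have ne: "i \<noteq> j" "i \<noteq> k" "j \<noteq> k" using xyz ijk by auto
    obtain u where u: "\<And>a b. a \<in> T \<Longrightarrow> b \<in> T \<Longrightarrow> \<exists>c. a - b = c *\<^sub>R u"
      using col unfolding collinear_def by blast
    obtain c where c: "p i - p j = c *\<^sub>R u" using u xyz ijk by blast
    obtain d where d: "p i - p k = d *\<^sub>R u" using u xyz ijk by blast
    have "(p i - p j) $ 1 * (p i - p k) $ 2 = (p i - p j) $ 2 * (p i - p k) $ 1"
      unfolding c d by simp
    then have "(real i - real j) * (real i ^ 2 - real k ^ 2)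
             = (real i ^ 2 - real j ^ 2) * (real i - real k)"
      by (simp add: p1 p2)
    then have "(real i - real j) * (real i - real k) * (real k - real j) = 0"
      by (simp add: algebra_simps power2_eq_square)
    then show False using ne by auto
  qed
  then have "general_position (p ` {..<n})" by (simp add: general_position_def)
  then show ?thesis
    unfolding geometric_graph_of_def complete_graph_def using inj by auto
qed

end

theory Submission
  imports Defs
begin

text \<open>
  The bound already holds for every drawing of \<open>K\<^sub>n\<close>, and without a linear error term.
  If two colors are each used on a single edge, then the edge of the larger color can only be
  adjacent to the edge of the smaller one, so these two edges are disjoint and in particular share
  no endpoint. The edges that are alone in their color class thus form a matching, and there are at
  most \<open>n / 2\<close> of them. Every other color uses at least two edges. Hence \<open>k\<close> colors need at least
  \<open>2 k - n / 2\<close> edges, and comparing this with the \<open>n (n - 1) / 2\<close> edges of \<open>K\<^sub>n\<close> gives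
  \<open>k \<le> n\<^sup>2 / 4\<close>.
\<close>

text \<open>The edges counted here form a matching: an edge of the larger color needs a neighbour in the
  smaller color, and that class has only one candidate.\<close>

lemma two_card_singleton_colors_le:
  assumes c: "pseudo_grundy_coloring D k c"
    and fin: "finite (fst D)"
    and edge: "\<And>e. e \<in> snd D \<Longrightarrow> e \<subseteq> fst D \<and> card e = 2"
  shows "2 * card {i \<in> {1..k}. card {e \<in> snd D. c e = i} = 1} \<le> card (fst D)"
proof -
  define S where "S = {i \<in> {1..k}. card {e \<in> snd D. c e = i} = 1}"
  have "\<exists>f. \<forall>i\<in>S. {e \<in> snd D. c e = i} = {f i}"
    by (rule bchoice) (auto simp: S_def card_1_singleton_iff)
  then obtain f where "\<forall>i\<in>S. {e \<in> snd D. c e = i} = {f i}" ..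
  then have f: "{e \<in> snd D. c e = i} = {f i}" if "i \<in> S" for i
    using that by (rule bspec)
  have fE: "f i \<in> snd D" "c (f i) = i" if "i \<in> S" for i
    using f[OF that] by auto
  have fV: "f i \<subseteq> fst D" "card (f i) = 2" if "i \<in> S" for i
    using edge[OF fE(1)[OF that]] by auto
  have less: "f i \<inter> f j = {}" if ij: "i \<in> S" "j \<in> S" "i < j" for i j
  proof -
    have "i \<in> {1..k}" "j \<in> {1..k}"
      using ij by (auto simp: S_def)
    then obtain g where g: "g \<in> snd D" "c g = i" "edges_adjacent (f j) g"
      using c fE[OF ij(2)] ij(3) unfolding pseudo_grundy_coloring_def by meson
    have "g = f i"
      using f[OF ij(1)] g by auto
    then show ?thesis
      using g(3) by (auto simp: edges_adjacent_def edges_intersect_def)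
  qed
  have disj: "f i \<inter> f j = {}" if "i \<in> S" "j \<in> S" "i \<noteq> j" for i j
    using less[of i j] less[of j i] that by (cases i j rule: linorder_cases) auto
  have "card (\<Union>i\<in>S. f i) = (\<Sum>i\<in>S. card (f i))"
  proof (rule card_UN_disjoint)
    show "finite S" by (simp add: S_def)
    show "\<forall>i\<in>S. finite (f i)" using fV(1) fin finite_subset by metis
    show "\<forall>i\<in>S. \<forall>j\<in>S. i \<noteq> j \<longrightarrow> f i \<inter> f j = {}" using disj by blast
  qed
  also have "\<dots> = 2 * card S"
    using fV(2) by simp
  finally have "2 * card S = card (\<Union>i\<in>S. f i)" ..
  also have "\<dots> \<le> card (fst D)"
    using fV(1) fin by (intro card_mono) auto
  finally show ?thesis
    by (simp only: S_def)
qed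

text \<open>Double counting of the edges by color: each color contributes at least two edges, except for
  the colors bounded above, which fall short by one.\<close>

lemma pseudo_grundy_colors_le:
  assumes c: "pseudo_grundy_coloring D k c"
    and fin: "finite (fst D)"
    and edge: "\<And>e. e \<in> snd D \<Longrightarrow> e \<subseteq> fst D \<and> card e = 2"
  shows "4 * k \<le> 2 * card (snd D) + card (fst D)"
proof -
  define cls where "cls i = {e \<in> snd D. c e = i}" for i
  define S where "S = {i \<in> {1..k}. card (cls i) = 1}"
  have finE: "finite (snd D)"
    using edge fin by (intro finite_subset[of "snd D" "Pow (fst D)"]) auto
  have img: "c ` snd D = {1..k}"
    using c by (simp add: pseudo_grundy_coloring_def)
  have "2 * k = (\<Sum>i\<in>{1..k}. 2)"
    by simp
  also have "\<dots> \<le> (\<Sum>i\<in>{1..k}. card (cls i) + (if i \<in> S then 1 else 0))"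
  proof (rule sum_mono)
    fix i assume i: "i \<in> {1..k}"
    then have "i \<in> c ` snd D"
      using img by simp
    then have "cls i \<noteq> {}"
      by (auto simp: cls_def)
    then have "card (cls i) > 0"
      using finE by (simp add: cls_def card_gt_0_iff)
    then show "2 \<le> card (cls i) + (if i \<in> S then 1 else 0)"
      using i by (auto simp: S_def)
  qed
  also have "\<dots> = (\<Sum>i\<in>{1..k}. card (cls i)) + card S"
    by (simp add: sum.distrib S_def flip: sum.inter_filter)
  also have "(\<Sum>i\<in>{1..k}. card (cls i)) = card (snd D)"
    using sum.group[of "snd D" "{1..k}" c "\<lambda>_. 1::nat"] finE img by (simp add: cls_def)
  finally have "2 * k \<le> card (snd D) + card S" .
  moreover have "2 * card S \<le> card (fst D)"
    using two_card_singleton_colors_le[OF c fin edge] by (simp add: S_def cls_def)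
  ultimately show ?thesis
    by linarith
qed

lemma pseudo_grundy_index_drawing_complete_graph_le:
  assumes "geometric_graph_of D (complete_graph n)"
  shows "4 * pseudo_grundy_index D \<le> n\<^sup>2"
proof -
  define K where "K = {e. e \<subseteq> {..<n} \<and> card e = 2}"
  obtain p where p: "inj_on p {..<n}"
    and V: "fst D = p ` {..<n}" and E: "snd D = (\<lambda>e. p ` e) ` K"
    using assms unfolding geometric_graph_of_def complete_graph_def K_def by auto
  have finK: "finite K"
    unfolding K_def by (rule finite_subset[of _ "Pow {..<n}"]) auto
  have finE: "finite (snd D)"
    using finK E by simp
  have finV: "finite (fst D)"
    using V by simp
  have cardV: "card (fst D) = n"
    using p V by (simp add: card_image)
  have "card (snd D) \<le> card K"
    using finK E by (simp add: card_image_le)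
  also have "card K = n choose 2"
    unfolding K_def by (simp add: n_subsets)
  finally have cardE: "2 * card (snd D) \<le> n * (n - 1)"
    by (simp add: choose_two)
  have edge: "e \<subseteq> fst D \<and> card e = 2" if "e \<in> snd D" for e
    using that p unfolding V E K_def
    by (auto simp: card_image[OF inj_on_subset[OF p]])
  have "pseudo_grundy_index D \<in> {k. \<exists>c. pseudo_grundy_coloring D k c}"
    unfolding pseudo_grundy_index_def
    using ex_pseudo_grundy by (intro Max_in finite_pseudo_grundy[OF finE]) auto
  then obtain c where "pseudo_grundy_coloring D (pseudo_grundy_index D) c"
    by blast
  from pseudo_grundy_colors_le[OF this finV edge]
  have "4 * pseudo_grundy_index D \<le> n * (n - 1) + n"
    using cardE cardV by simp
  also have "\<dots> = n\<^sup>2"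
    by (cases n) (auto simp: power2_eq_square)
  finally show ?thesis .
qed

theorem theorem9:
  "\<exists>C::real. C > 0 \<and>
     (\<forall>n::nat. n \<ge> 4 \<longrightarrow>
        real (geometric_pseudo_grundy_index (complete_graph n)) \<le> (real n)\<^sup>2 / 4 + C * real n)"
proof (intro exI[of _ 1] conjI allI impI)
  fix n :: nat
  obtain D where D: "geometric_graph_of D (complete_graph n)"
    using ex_drawing_complete_graph by blast
  have "geometric_pseudo_grundy_index (complete_graph n) \<le> pseudo_grundy_index D"
    unfolding geometric_pseudo_grundy_index_def using D by (intro cInf_lower) blast+
  with pseudo_grundy_index_drawing_complete_graph_le[OF D]
  have "4 * geometric_pseudo_grundy_index (complete_graph n) \<le> n\<^sup>2"
    by linarith
  then have "4 * real (geometric_pseudo_grundy_index (complete_graph n)) \<le> (real n)\<^sup>2"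
    by (metis of_nat_le_iff of_nat_mult of_nat_numeral of_nat_power)
  then show "real (geometric_pseudo_grundy_index (complete_graph n)) \<le> (real n)\<^sup>2 / 4 + 1 * real n"
    by simp
qed simp

end
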